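(* Let $A=(\Sigma,Q,\delta,I)$ be a top-down tree automaton and let ${\equiv^{\mathsf{up}}(\mathrm{id})}:={\subseteq^{\mathsf{up}}(\mathrm{id})}\cap(\subseteq^{\mathsf{up}}(\mathrm{id}))^{-1}$ be the equivalence relation induced by the upward trace inclusion preorder $\subseteq^{\mathsf{up}}(\mathrm{id})$ on $A$ (induced by the identity). Then $\equiv^{\mathsf{up}}(\mathrm{id})$ is good for quotienting, i.e. $L(A/{\equiv^{\mathsf{up}}(\mathrm{id})})=L(A)$.
   Context: **Trees.** A ranked alphabet $\Sigma$ is a set of symbols with a rank function $\#:\Sigma\to\mathbb N_0$. Nodes are finite sequences of positive integers; $\varepsilon$ is the empty sequence. A tree over $\Sigma$ is a partial map $t$ from nodes to $\Sigma$ with finite nonempty domain such that if $vi\in\mathrm{dom}(t)$ ($i\ge1$) then $v\in\mathrm{dom}(t)$ and $i\le\#(t(v))$ (some children may be missing). A tree is closed if every $v\in\mathrm{dom}(t)$ has exactly $\#(t(v))$ children in $\mathrm{dom}(t)$. **Automata.** A top-down tree automaton (TDTA) is $A=(\Sigma,Q,\delta,I)$ with $Q$ a finite set of states, $I\subseteq Q$ the initial states, a unique final state $\psi\in Q$ which has no outgoing transitions, and $\delta\subseteq Q\times\Sigma\times Q^+$ a set of transitions, each of the form $\langle q,a,\psi\rangle$ with $\#(a)=0$ or $\langle q,a,q_1\dots q_n\rangle$ with $n=\#(a)\ge1$. A run of $A$ on a tree $t$ (a $t$-run) is a map $\pi$ to $Q$ with domain $\mathrm{dom}(t)\cup\{vi: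 v\in\mathrm{dom}(t),1\le i\le\#(t(v))\}$ such that for every $v\in\mathrm{dom}(t)$: if $\#(t(v))=0$ then $\langle\pi(v),t(v),\psi\rangle\in\delta$, and if $n=\#(t(v))\ge1$ then $\langle\pi(v),t(v),\pi(v1)\dots\pi(vn)\rangle\in\delta$. A dangling leaf of $\pi$ is a node in $\mathrm{dom}(\pi)\setminus\mathrm{dom}(t)$. The language $L(A)$ is the set of closed trees $t$ having a $t$-run $\pi$ with $\pi(\varepsilon)\in I$. **Upward trace inclusion.** For a relation $S$ on $Q$, $q\subseteq^{\mathsf{up}}(S)\,r$ iff ($q=\psi\Rightarrow r=\psi$), ($q\in I\Rightarrow r\in I$), and for every tree $t$, every $t$-run $\pi_q$ and every dangling leaf $v$ of $\pi_q$ with $\pi_q(v)=q$ there is a $t$-run $\pi_r$ such that (1) $\pi_r(v)=r$; (2) for all prefixes $v'$ of $v$, $\pi_q(v')\in I\Rightarrow\pi_r(v')\in I$; (3) whenever $v'$ is a strict prefix of $v$ and $v'x\in\mathrm{dom}(\pi_q)$ ($x\ge1$ an integer) is not a prefix of $v$, then $\pi_q(v'x)\,S\,\pi_r(v'x)$. Here $S=\mathrm{id}$ is the identity relation on $Q$. **Quotienting.** For an equivalence relation $\equiv$ on $Q$, with $[q]$ the class of $q$ and $[S]=\{[s]:s\in S\}$, the quotient automaton is $A/{\equiv}=(\Sigma,[Q],\delta_{A/\equiv},[I])$ with final state $[\psi]$ and $\delta_{A/\equiv}=\{\langle[q],\sigma,[q_1]\dots[q_n]\rangle:\langle q,\sigma,q_1\dots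 q_n\rangle\in\delta\}$. $\equiv$ is good for quotienting (GFQ) iff $L(A/{\equiv})=L(A)$. *)

theory Defs
  imports Main "HOL-Library.Sublist"
begin

type_synonym node = "nat list"

text \<open>
  The condition on the domain forces all entries of nodes to be positive, and it permits missing
  children.
\<close>

definition is_tree :: "'a set \<Rightarrow> ('a \<Rightarrow> nat) \<Rightarrow> (node \<rightharpoonup> 'a) \<Rightarrow> bool" where
  "is_tree \<Sigma> rk t \<longleftrightarrow>
     finite (dom t) \<and> dom t \<noteq> {} \<and> ran t \<subseteq> \<Sigma> \<and>
     (\<forall>v i. v @ [i] \<in> dom t \<longrightarrow> 1 \<le> i \<and> v \<in> dom t \<and> i \<le> rk (the (t v)))"

definition closed_tree :: "('a \<Rightarrow> nat) \<Rightarrow> (node \<rightharpoonup> 'a) \<Rightarrow> bool" where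
  "closed_tree rk t \<longleftrightarrow> (\<forall>v\<in>dom t. card {i. v @ [i] \<in> dom t} = rk (the (t v)))"

record ('q, 'a) automaton =
  symbols :: "'a set"
  rank :: "'a \<Rightarrow> nat"
  states :: "'q set"
  delta :: "('q \<times> 'a \<times> 'q list) set"
  initial :: "'q set"
  final :: 'q

locale tdta =
  fixes A :: "('q, 'a) automaton"
  assumes finite_states: "finite (states A)"
    and initial_states: "initial A \<subseteq> states A"
    and final_state: "final A \<in> states A"
    and final_no_trans: "(final A, a, qs) \<notin> delta A"
    and trans_carrier: "(q, a, qs) \<in> delta A \<Longrightarrow>
      q \<in> states A \<and> a \<in> symbols A \<and> set qs \<subseteq> states A"
    and trans_form: "(q, a, qs) \<in> delta A \<Longrightarrow>
      (rank A a = 0 \<and> qs = [final A]) \<or> (rank A a \<ge> 1 \<and> length qs = rank A a)"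

abbreviation tree_over :: "('q, 'a) automaton \<Rightarrow> (node \<rightharpoonup> 'a) \<Rightarrow> bool" where
  "tree_over A t \<equiv> is_tree (symbols A) (rank A) t"

definition is_run :: "('q, 'a) automaton \<Rightarrow> (node \<rightharpoonup> 'a) \<Rightarrow> (node \<rightharpoonup> 'q) \<Rightarrow> bool" where
  "is_run A t \<pi> \<longleftrightarrow>
     dom \<pi> = dom t \<union> {v @ [i] |v i. v \<in> dom t \<and> 1 \<le> i \<and> i \<le> rank A (the (t v))} \<and>
     ran \<pi> \<subseteq> states A \<and>
     (\<forall>v\<in>dom t. let a = the (t v); n = rank A a in
        if n = 0 then (the (\<pi> v), a, [final A]) \<in> delta A
        else (the (\<pi> v), a, map (\<lambda>i. the (\<pi> (v @ [i]))) [1..<Suc n]) \<in> delta A)"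

definition dangling_leaf :: "(node \<rightharpoonup> 'a) \<Rightarrow> (node \<rightharpoonup> 'q) \<Rightarrow> node \<Rightarrow> bool" where
  "dangling_leaf t \<pi> v \<longleftrightarrow> v \<in> dom \<pi> - dom t"

definition language :: "('q, 'a) automaton \<Rightarrow> (node \<rightharpoonup> 'a) set" where
  "language A = {t. tree_over A t \<and> closed_tree (rank A) t \<and>
     (\<exists>\<pi>. is_run A t \<pi> \<and> the (\<pi> []) \<in> initial A)}"

definition up_incl :: "('q, 'a) automaton \<Rightarrow> 'q rel \<Rightarrow> 'q rel" where
  "up_incl A S = {(q, r). q \<in> states A \<and> r \<in> states A \<and>
     (q = final A \<longrightarrow> r = final A) \<and>
     (q \<in> initial A \<longrightarrow> r \<in> initial A) \<and>
     (\<forall>t \<pi>\<^sub>q v. tree_over A t \<and> is_run A t \<pi>\<^sub>q \<and> dangling_leaf t \<pi>\<^sub>q v \<and> the (\<pi>\<^sub>q v) = q \<longrightarrow>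
        (\<exists>\<pi>\<^sub>r. is_run A t \<pi>\<^sub>r \<and> the (\<pi>\<^sub>r v) = r \<and>
           (\<forall>v'. prefix v' v \<longrightarrow> the (\<pi>\<^sub>q v') \<in> initial A \<longrightarrow> the (\<pi>\<^sub>r v') \<in> initial A) \<and>
           (\<forall>v' x. strict_prefix v' v \<and> v' @ [x] \<in> dom \<pi>\<^sub>q \<and> \<not> prefix (v' @ [x]) v \<longrightarrow>
              (the (\<pi>\<^sub>q (v' @ [x])), the (\<pi>\<^sub>r (v' @ [x]))) \<in> S)))}"

definition up_equiv :: "('q, 'a) automaton \<Rightarrow> 'q rel \<Rightarrow> 'q rel" where
  "up_equiv A S = up_incl A S \<inter> (up_incl A S)\<inverse>"

definition quotient_automaton :: "('q, 'a) automaton \<Rightarrow> 'q rel \<Rightarrow> ('q set, 'a) automaton" where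
  "quotient_automaton A R =
     \<lparr>symbols = symbols A,
      rank = rank A,
      states = states A // R,
      delta = {(R `` {q}, a, map (\<lambda>p. R `` {p}) qs) |q a qs. (q, a, qs) \<in> delta A},
      initial = (\<lambda>q. R `` {q}) ` initial A,
      final = R `` {final A}\<rparr>"

definition good_for_quotienting :: "('q, 'a) automaton \<Rightarrow> 'q rel \<Rightarrow> bool" where
  "good_for_quotienting A R \<longleftrightarrow> language (quotient_automaton A R) = language A"

lemma up_incl_refl: "q \<in> states A \<Longrightarrow> (q, q) \<in> up_incl A (Id_on (states A))"
  unfolding up_incl_def
proof (simp, intro allI impI, elim conjE, goal_cases)
  case (1 t \<pi> v)
  have "the (\<pi> w) \<in> states A" if w: "w \<in> dom \<pi>" for w
  proof -
    obtain p where "\<pi> w = Some p" using w by (auto simp: dom_def)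
    moreover have "ran \<pi> \<subseteq> states A" using 1 by (simp only: is_run_def)
    ultimately show ?thesis by (auto dest: ranI)
  qed
  with 1 show ?case
    by (intro exI[of _ \<pi>]) (blast intro: Id_onI)
qed

lemma up_incl_trans:
  assumes qr: "(q, r) \<in> up_incl A (Id_on (states A))"
    and rs: "(r, s) \<in> up_incl A (Id_on (states A))"
  shows "(q, s) \<in> up_incl A (Id_on (states A))"
proof -
  have "\<exists>\<pi>\<^sub>s. is_run A t \<pi>\<^sub>s \<and> the (\<pi>\<^sub>s v) = s \<and>
      (\<forall>v'. prefix v' v \<longrightarrow> the (\<pi>\<^sub>q v') \<in> initial A \<longrightarrow> the (\<pi>\<^sub>s v') \<in> initial A) \<and>
      (\<forall>v' x. strict_prefix v' v \<and> v' @ [x] \<in> dom \<pi>\<^sub>q \<and> \<not> prefix (v' @ [x]) v \<longrightarrow>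
        (the (\<pi>\<^sub>q (v' @ [x])), the (\<pi>\<^sub>s (v' @ [x]))) \<in> Id_on (states A))"
    if t: "tree_over A t" and run_q: "is_run A t \<pi>\<^sub>q" and v: "dangling_leaf t \<pi>\<^sub>q v"
      and q: "the (\<pi>\<^sub>q v) = q" for t \<pi>\<^sub>q v
  proof -
    obtain \<pi>\<^sub>r where r: "is_run A t \<pi>\<^sub>r" "the (\<pi>\<^sub>r v) = r"
      "\<forall>v'. prefix v' v \<longrightarrow> the (\<pi>\<^sub>q v') \<in> initial A \<longrightarrow> the (\<pi>\<^sub>r v') \<in> initial A"
      "\<forall>v' x. strict_prefix v' v \<and> v' @ [x] \<in> dom \<pi>\<^sub>q \<and> \<not> prefix (v' @ [x]) v \<longrightarrow>
         (the (\<pi>\<^sub>q (v' @ [x])), the (\<pi>\<^sub>r (v' @ [x]))) \<in> Id_on (states A)"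
      using qr t run_q v q unfolding up_incl_def by blast
    have dom: "dom \<pi>\<^sub>r = dom \<pi>\<^sub>q"
      using run_q r(1) by (simp add: is_run_def)
    then have "dangling_leaf t \<pi>\<^sub>r v"
      using v by (simp add: dangling_leaf_def)
    then obtain \<pi>\<^sub>s where s: "is_run A t \<pi>\<^sub>s" "the (\<pi>\<^sub>s v) = s"
      "\<forall>v'. prefix v' v \<longrightarrow> the (\<pi>\<^sub>r v') \<in> initial A \<longrightarrow> the (\<pi>\<^sub>s v') \<in> initial A"
      "\<forall>v' x. strict_prefix v' v \<and> v' @ [x] \<in> dom \<pi>\<^sub>r \<and> \<not> prefix (v' @ [x]) v \<longrightarrow>
         (the (\<pi>\<^sub>r (v' @ [x])), the (\<pi>\<^sub>s (v' @ [x]))) \<in> Id_on (states A)"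
      using rs t r(1,2) unfolding up_incl_def by blast
    have "(the (\<pi>\<^sub>q (v' @ [x])), the (\<pi>\<^sub>s (v' @ [x]))) \<in> Id_on (states A)"
      if "strict_prefix v' v \<and> v' @ [x] \<in> dom \<pi>\<^sub>q \<and> \<not> prefix (v' @ [x]) v" for v' x
      using r(4)[rule_format, OF that] s(4)[rule_format, unfolded dom, OF that]
      by (auto simp only: Id_on_iff)
    then show ?thesis
      using r(3) s(1,2,3) by blast
  qed
  moreover have "q \<in> states A" "s \<in> states A" "q = final A \<longrightarrow> s = final A"
    "q \<in> initial A \<longrightarrow> s \<in> initial A"
    using qr rs by (auto simp: up_incl_def)
  ultimately show ?thesis
    unfolding up_incl_def by blast
qed

lemma equiv_up_equiv: "equiv (states A) (up_equiv A (Id_on (states A)))"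
proof (rule equivI)
  show "up_equiv A (Id_on (states A)) \<subseteq> states A \<times> states A"
    by (auto simp: up_equiv_def up_incl_def)
  show "refl_on (states A) (up_equiv A (Id_on (states A)))"
    by (auto simp: refl_on_def up_equiv_def intro: up_incl_refl)
  show "sym (up_equiv A (Id_on (states A)))"
    by (auto simp: sym_def up_equiv_def)
  show "trans (up_equiv A (Id_on (states A)))"
    by (auto simp: trans_def up_equiv_def intro: up_incl_trans)
qed

lemma tdta_quotient_up_equiv:
  assumes "tdta A"
  shows "tdta (quotient_automaton A (up_equiv A (Id_on (states A))))"
proof -
  interpret tdta A by fact
  let ?R = "up_equiv A (Id_on (states A))"
  note eq = equiv_up_equiv[of A]
  have final: "q = final A" if "?R `` {q} = ?R `` {final A}" "q \<in> states A" for q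
  proof -
    have "(final A, q) \<in> ?R"
      using eq_equiv_class[OF that(1)[symmetric] eq that(2)] .
    then show ?thesis by (simp add: up_equiv_def up_incl_def)
  qed
  show ?thesis
  proof (unfold_locales, goal_cases)
    case 1
    show ?case
      using finite_states equiv_type[OF eq] by (simp add: quotient_automaton_def finite_quotient)
  next
    case 2
    show ?case using initial_states by (auto simp: quotient_automaton_def intro: quotientI)
  next
    case 3
    show ?case using final_state by (auto simp: quotient_automaton_def intro: quotientI)
  next
    case (4 a qs)
    show ?case
    proof
      assume "(final (quotient_automaton A ?R), a, qs) \<in> delta (quotient_automaton A ?R)"
      then obtain q ps where "?R `` {q} = ?R `` {final A}" "(q, a, ps) \<in> delta A"
        by (auto simp: quotient_automaton_def)
      then show False using final trans_carrier final_no_trans by metis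
    qed
  next
    case (5 q a qs)
    then show ?case
      by (auto simp: quotient_automaton_def dest!: trans_carrier intro!: quotientI)
  next
    case (6 q a qs)
    then show ?case
      by (auto simp: quotient_automaton_def dest: trans_form)
  qed
qed

end

theory Submission
  imports Defs
begin

text \<open>
  A run of the quotient automaton on a closed tree is turned into a run of the original automaton
  by growing a partial tree one node at a time. The invariant is a run of \<^term>\<open>A\<close> on the partial
  tree with initial root whose states at the dangling leaves belong to the classes chosen by the
  quotient run. To add a dangling leaf \<^term>\<open>v\<close>, its state is first changed to the equivalent state
  from which the required transition leaves; upward trace inclusion changes only the states on the
  path from the root to \<^term>\<open>v\<close>, because below the siblings of this path, where the states agree,
  the old run can be kept.
\<close>

section \<open>Trees and the nodes on which runs are defined\<close>

text \<open>Depends only on the tree and the ranks, so all runs on one tree share this domain,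
  including those of the quotient automaton, which keeps the ranks.\<close>

definition run_domain :: "('a \<Rightarrow> nat) \<Rightarrow> (node \<rightharpoonup> 'a) \<Rightarrow> node set" where
  "run_domain rk t = dom t \<union> {v @ [i] |v i. v \<in> dom t \<and> 1 \<le> i \<and> i \<le> rk (the (t v))}"

text \<open>Using \<open>[final A]\<close> for rank 0 mirrors the shape of \<open>delta\<close>, so
  that \<open>is_run_iff\<close> has a single membership condition per node.\<close>

definition succ_states :: "('q, 'a) automaton \<Rightarrow> 'a \<Rightarrow> (node \<rightharpoonup> 'q) \<Rightarrow> node \<Rightarrow> 'q list" where
  "succ_states A a \<pi> v =
     (if rank A a = 0 then [final A] else map (\<lambda>i. the (\<pi> (v @ [i]))) [1..<Suc (rank A a)])"

lemma is_run_iff: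
  "is_run A t \<pi> \<longleftrightarrow> dom \<pi> = run_domain (rank A) t \<and> ran \<pi> \<subseteq> states A \<and>
     (\<forall>v\<in>dom t. (the (\<pi> v), the (t v), succ_states A (the (t v)) \<pi> v) \<in> delta A)"
  by (simp add: is_run_def run_domain_def succ_states_def Let_def if_distrib
      cong: if_cong)

lemma succ_states_cong:
  assumes "\<And>i. 1 \<le> i \<Longrightarrow> i \<le> rank A a \<Longrightarrow> the (\<pi> (v @ [i])) = the (\<sigma> (v @ [i]))"
  shows "succ_states A a \<pi> v = succ_states A a \<sigma> v"
  using assms by (auto simp: succ_states_def)

lemma child_in_run_domain:
  "v \<in> dom t \<Longrightarrow> 1 \<le> i \<Longrightarrow> i \<le> rk (the (t v)) \<Longrightarrow> v @ [i] \<in> run_domain rk t"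
  by (auto simp: run_domain_def)

lemma run_domain_parent:
  assumes "is_tree \<Sigma> rk t" "v @ [i] \<in> run_domain rk t"
  shows "v \<in> dom t"
  using assms unfolding run_domain_def is_tree_def by blast

lemma tree_prefix_closed:
  assumes t: "is_tree \<Sigma> rk t" and "w @ u \<in> dom t"
  shows "w \<in> dom t"
  using assms(2)
proof (induction u rule: rev_induct)
  case (snoc i u)
  then have "(w @ u) @ [i] \<in> dom t" by simp
  then have "w @ u \<in> dom t" using t unfolding is_tree_def by blast
  then show ?case by (rule snoc.IH)
qed simp

lemma run_domain_strict_prefix:
  assumes t: "is_tree \<Sigma> rk t" and v: "v \<in> run_domain rk t" and wv: "strict_prefix w v"
  shows "w \<in> dom t"
proof -
  obtain u where u: "v = w @ u" "u \<noteq> []"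
    using wv by (auto simp: strict_prefix_def prefix_def)
  then have "v = (w @ butlast u) @ [last u]" by simp
  then have "w @ butlast u \<in> dom t" using run_domain_parent[OF t] v by metis
  then show ?thesis by (rule tree_prefix_closed[OF t])
qed

lemma root_in_dom:
  assumes "is_tree \<Sigma> rk t"
  shows "[] \<in> dom t"
proof -
  obtain w where "w \<in> dom t" using assms unfolding is_tree_def by blast
  then show ?thesis using tree_prefix_closed[OF assms, of "[]" w] by simp
qed

text \<open>Closedness only counts children. By the tree condition their indices lie between 1 and
  the rank, and a subset of full cardinality is everything.\<close>

lemma closed_tree_child:
  assumes t: "is_tree \<Sigma> rk t" and c: "closed_tree rk t" and v: "v \<in> dom t"
    and i: "1 \<le> i" "i \<le> rk (the (t v))"
  shows "v @ [i] \<in> dom t"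
proof -
  have "{i. v @ [i] \<in> dom t} \<subseteq> {1..rk (the (t v))}"
    using t unfolding is_tree_def by (intro subsetI) (simp only: mem_Collect_eq atLeastAtMost_iff)
  moreover have "card {i. v @ [i] \<in> dom t} = card {1..rk (the (t v))}"
    using c v by (simp add: closed_tree_def)
  ultimately have "{i. v @ [i] \<in> dom t} = {1..rk (the (t v))}"
    by (intro card_subset_eq) auto
  then show ?thesis using i by auto
qed

section \<open>Modifying a run at a dangling leaf\<close>

text \<open>The run that \<open>up_incl\<close> provides may differ from \<pi> below the siblings of
  the path to \<open>v\<close>. It is therefore used on the prefixes of \<open>v\<close> only, with
  \<pi> everywhere else, so that the states at all other dangling leaves survive.\<close>

lemma run_replace_state:
  assumes incl: "(q, r) \<in> up_incl A (Id_on (states A))"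
    and t: "tree_over A t" and run: "is_run A t \<pi>"
    and v: "dangling_leaf t \<pi> v" "the (\<pi> v) = q"
  obtains \<sigma> where "is_run A t \<sigma>" "the (\<sigma> v) = r"
    "\<And>w. \<not> prefix w v \<Longrightarrow> \<sigma> w = \<pi> w"
    "the (\<pi> []) \<in> initial A \<Longrightarrow> the (\<sigma> []) \<in> initial A"
proof -
  obtain \<pi>' where run': "is_run A t \<pi>'" and r: "the (\<pi>' v) = r"
    and init: "\<forall>v'. prefix v' v \<longrightarrow> the (\<pi> v') \<in> initial A \<longrightarrow> the (\<pi>' v') \<in> initial A"
    and sib: "\<forall>v' x. strict_prefix v' v \<and> v' @ [x] \<in> dom \<pi> \<and> \<not> prefix (v' @ [x]) v \<longrightarrow>
       (the (\<pi> (v' @ [x])), the (\<pi>' (v' @ [x]))) \<in> Id_on (states A)"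
    using incl t run v unfolding up_incl_def by blast
  define \<sigma> where "\<sigma> w = (if prefix w v then \<pi>' w else \<pi> w)" for w
  have dom: "dom \<pi> = run_domain (rank A) t" "dom \<pi>' = run_domain (rank A) t"
    using run run' by (simp_all add: is_run_iff)
  have "v \<notin> dom t" using v by (simp add: dangling_leaf_def)
  have "is_run A t \<sigma>"
    unfolding is_run_iff
  proof (intro conjI ballI)
    show "dom \<sigma> = run_domain (rank A) t"
      using dom by (auto simp: \<sigma>_def dom_def split: if_splits)
    show "ran \<sigma> \<subseteq> states A"
      using run run' by (force simp: \<sigma>_def is_run_iff ran_def split: if_splits)
  next
    fix w assume w: "w \<in> dom t"
    let ?a = "the (t w)"
    show "(the (\<sigma> w), ?a, succ_states A ?a \<sigma> w) \<in> delta A"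
    proof (cases "prefix w v")
      case True
      \<comment> \<open>Tree nodes differ from the dangling leaf \<open>v\<close>, so the sibling
        condition, stated for strict prefixes, applies to \<open>w\<close>.\<close>
      then have "strict_prefix w v"
        using w \<open>v \<notin> dom t\<close> by (auto simp: strict_prefix_def)
      \<comment> \<open>A child of \<open>w\<close> is either the next node of the path, where
        \<sigma> is \<open>\<pi>'\<close> by definition, or a sibling of it, where both runs agree
        because the relation is the identity.\<close>
      have "succ_states A ?a \<sigma> w = succ_states A ?a \<pi>' w"
      proof (rule succ_states_cong)
        fix i assume "1 \<le> i" "i \<le> rank A ?a"
        then have "w @ [i] \<in> dom \<pi>"
          unfolding dom using child_in_run_domain[OF w] by blast
        then show "the (\<sigma> (w @ [i])) = the (\<pi>' (w @ [i]))"
          using sib \<open>strict_prefix w v\<close> by (auto simp only: \<sigma>_def Id_on_iff split: if_splits)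
      qed
      then show ?thesis
        using True run' w by (simp add: \<sigma>_def is_run_iff)
    next
      case False
      then have "succ_states A ?a \<sigma> w = succ_states A ?a \<pi> w"
        by (intro succ_states_cong) (auto simp: \<sigma>_def dest: append_prefixD)
      then show ?thesis
        using False run w by (simp add: \<sigma>_def is_run_iff)
    qed
  qed
  moreover have "the (\<sigma> v) = r" "\<And>w. \<not> prefix w v \<Longrightarrow> \<sigma> w = \<pi> w"
    "the (\<pi> []) \<in> initial A \<Longrightarrow> the (\<sigma> []) \<in> initial A"
    using r init by (simp_all add: \<sigma>_def)
  ultimately show ?thesis by (rule that)
qed

text \<open>
  The hypothesis on \<^term>\<open>dom \<pi>\<close> is weaker than \<^term>\<open>is_run A t \<pi>\<close> so that it also covers the empty
  map \<^term>\<open>t\<close> with \<^term>\<open>v = []\<close>.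
\<close>
lemma (in tdta) run_extend:
  assumes dom: "dom \<pi> = insert v (run_domain (rank A) t)" and ran: "ran \<pi> \<subseteq> states A"
    and trans: "\<And>w. w \<in> dom t \<Longrightarrow>
      (the (\<pi> w), the (t w), succ_states A (the (t w)) \<pi> w) \<in> delta A"
    and v: "v \<notin> dom t" "\<And>i. v @ [i] \<notin> dom t" and step: "(the (\<pi> v), a, qs) \<in> delta A"
  obtains \<sigma> where "is_run A (t(v \<mapsto> a)) \<sigma>"
    "\<And>i. 1 \<le> i \<Longrightarrow> i \<le> rank A a \<Longrightarrow> \<sigma> (v @ [i]) = Some (qs ! (i - 1))"
    "\<And>w. (\<And>i. 1 \<le> i \<Longrightarrow> i \<le> rank A a \<Longrightarrow> w \<noteq> v @ [i]) \<Longrightarrow> \<sigma> w = \<pi> w"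
proof -
  define C where "C = {v @ [i] |i. 1 \<le> i \<and> i \<le> rank A a}"
  \<comment> \<open>Child indices start at 1 and positions in \<open>qs\<close> at 0, hence the
    shift.\<close>
  define \<sigma> where "\<sigma> w = (if w \<in> C then Some (qs ! (last w - 1)) else \<pi> w)" for w
  have child: "\<sigma> (v @ [i]) = Some (qs ! (i - 1))" if "1 \<le> i" "i \<le> rank A a" for i
    using that by (auto simp: \<sigma>_def C_def)
  have other: "\<sigma> w = \<pi> w" if "\<And>i. 1 \<le> i \<Longrightarrow> i \<le> rank A a \<Longrightarrow> w \<noteq> v @ [i]" for w
    using that by (auto simp: \<sigma>_def C_def)
  have form: "rank A a = 0 \<and> qs = [final A] \<or> rank A a \<ge> 1 \<and> length qs = rank A a"
    and carrier: "set qs \<subseteq> states A"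
    using trans_form[OF step] trans_carrier[OF step] by auto
  have "is_run A (t(v \<mapsto> a)) \<sigma>"
    unfolding is_run_iff
  proof (intro conjI ballI)
    have "dom \<sigma> = C \<union> dom \<pi>" by (auto simp: \<sigma>_def dom_def)
    also have "\<dots> = run_domain (rank A) (t(v \<mapsto> a))"
    proof -
      have "{u @ [i] |u i. u \<in> dom (t(v \<mapsto> a)) \<and> 1 \<le> i \<and> i \<le> rank A (the ((t(v \<mapsto> a)) u))} =
          C \<union> {u @ [i] |u i. u \<in> dom t \<and> 1 \<le> i \<and> i \<le> rank A (the (t u))}" (is "?L = ?R")
      proof (rule set_eqI)
        fix w
        have "u \<noteq> v" if "u \<in> dom t" for u using v(1) that by blast
        then show "w \<in> ?L \<longleftrightarrow> w \<in> ?R"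
          unfolding C_def dom_fun_upd by (cases w rule: rev_cases) (auto simp: dom_def)
      qed
      then show ?thesis unfolding dom run_domain_def by auto
    qed
    finally show "dom \<sigma> = run_domain (rank A) (t(v \<mapsto> a))" .
  next
    have "q \<in> states A" if \<sigma>: "\<sigma> w = Some q" for w q
    proof (cases "w \<in> C")
      case True
      then obtain i where i: "w = v @ [i]" "1 \<le> i" "i \<le> rank A a" by (auto simp: C_def)
      \<comment> \<open>The index \<open>i\<close> excludes rank 0, so \<open>qs\<close> has as many
        entries as the rank.\<close>
      then have "i - 1 < length qs" using form by auto
      then show ?thesis using child[of i] i \<sigma> carrier by (auto dest: nth_mem)
    next
      case False
      then show ?thesis using \<sigma> ran by (auto simp: \<sigma>_def intro: ranI)
    qed
    then show "ran \<sigma> \<subseteq> states A" by (auto simp: ran_def)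
  next
    fix w assume w: "w \<in> dom (t(v \<mapsto> a))"
    let ?b = "the ((t(v \<mapsto> a)) w)"
    show "(the (\<sigma> w), ?b, succ_states A ?b \<sigma> w) \<in> delta A"
    proof (cases "w = v")
      case True
      have "succ_states A a \<sigma> v = qs"
        using form by (auto simp: succ_states_def child simp del: upt_Suc intro!: nth_equalityI)
      moreover have "\<sigma> v = \<pi> v" by (rule other) simp
      ultimately show ?thesis using True step by simp
    next
      case False
      with w have "w \<in> dom t" by auto
      \<comment> \<open>No child of \<open>v\<close> is a node of \<open>t\<close>, so overwriting
        the states at these children leaves all old tree nodes untouched.\<close>
      then have "\<sigma> w = \<pi> w" using v(2) by (auto simp: \<sigma>_def C_def)
      moreover have "succ_states A ?b \<sigma> w = succ_states A ?b \<pi> w"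
        using False by (intro succ_states_cong) (auto simp: \<sigma>_def C_def)
      ultimately show ?thesis using trans[OF \<open>w \<in> dom t\<close>] False by auto
    qed
  qed
  then show ?thesis using child other by (rule that)
qed

section \<open>From the automaton to its quotient\<close>

text \<open>Sending each state of an accepting run to its image under \<open>R\<close> gives an
  accepting run, since \<open>delta\<close> and \<open>initial\<close> of the quotient are images
  under this very map.\<close>

lemma language_subset_quotient:
  assumes "tdta A"
  shows "language A \<subseteq> language (quotient_automaton A R)"
proof
  interpret tdta A by fact
  let ?B = "quotient_automaton A R"
  fix t assume "t \<in> language A"
  then obtain \<pi> where t: "tree_over A t" "closed_tree (rank A) t"
    and run: "is_run A t \<pi>" and init: "the (\<pi> []) \<in> initial A"
    by (auto simp: language_def)
  define \<rho> where "\<rho> = map_option (\<lambda>q. R `` {q}) \<circ> \<pi>"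
  \<comment> \<open>Outside the domain of \<pi> the value of \<open>the\<close> is unspecified,
    hence the restriction.\<close>
  have the_\<rho>: "the (\<rho> w) = R `` {the (\<pi> w)}" if "w \<in> run_domain (rank A) t" for w
  proof -
    have "w \<in> dom \<pi>" using that run by (simp add: is_run_iff)
    then show ?thesis by (auto simp: \<rho>_def)
  qed
  have "is_run ?B t \<rho>"
    unfolding is_run_iff
  proof (intro conjI ballI)
    show "dom \<rho> = run_domain (rank ?B) t"
      using run by (auto simp: \<rho>_def is_run_iff quotient_automaton_def)
    show "ran \<rho> \<subseteq> states ?B"
      using run by (auto simp: \<rho>_def is_run_iff quotient_automaton_def ran_def intro!: quotientI)
  next
    fix v assume v: "v \<in> dom t"
    let ?a = "the (t v)"
    have "succ_states ?B ?a \<rho> v = map (\<lambda>p. R `` {p}) (succ_states A ?a \<pi> v)"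
      using the_\<rho> child_in_run_domain[OF v]
      by (auto simp: succ_states_def quotient_automaton_def simp del: upt_Suc)
    moreover have "the (\<rho> v) = R `` {the (\<pi> v)}"
      using v by (intro the_\<rho>) (simp add: run_domain_def)
    moreover have "(the (\<pi> v), ?a, succ_states A ?a \<pi> v) \<in> delta A"
      using run v by (simp add: is_run_iff)
    ultimately show "(the (\<rho> v), ?a, succ_states ?B ?a \<rho> v) \<in> delta ?B"
      by (auto simp: quotient_automaton_def)
  qed
  moreover have "the (\<rho> []) \<in> initial ?B"
    using the_\<rho>[of "[]"] root_in_dom[OF t(1)] init
    by (simp add: quotient_automaton_def run_domain_def)
  ultimately show "t \<in> language ?B"
    using t by (auto simp: language_def quotient_automaton_def)
qed

section \<open>From the quotient back to the automaton\<close>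

lemma language_quotient_subset:
  assumes "tdta A"
  shows "language (quotient_automaton A (up_equiv A (Id_on (states A)))) \<subseteq> language A"
proof
  interpret tdta A by fact
  define R where "R = up_equiv A (Id_on (states A))"
  have R: "equiv (states A) R" unfolding R_def by (rule equiv_up_equiv)
  let ?B = "quotient_automaton A R"
  fix t assume "t \<in> language (quotient_automaton A (up_equiv A (Id_on (states A))))"
  then obtain \<rho> where t: "tree_over A t" and closed: "closed_tree (rank A) t"
    and run: "is_run ?B t \<rho>" and init: "the (\<rho> []) \<in> initial ?B"
    by (auto simp: language_def quotient_automaton_def R_def)
  have finite: "finite (dom t)" and ran_t: "ran t \<subseteq> symbols A" using t by (auto simp: is_tree_def)
  have root: "[] \<in> dom t" by (rule root_in_dom[OF t])
  \<comment> \<open>Each quotient transition stems from a transition of \<open>A\<close> between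
    representatives. The source \<open>p\<close> chosen at \<open>v\<close> and the representative
    chosen for \<open>v\<close> as a child of its parent are merely equivalent;
    \<open>run_replace_state\<close> bridges this gap.\<close>
  have lift: "\<exists>p qs. (p, the (t v), qs) \<in> delta A \<and> the (\<rho> v) = R `` {p} \<and>
      (\<forall>i. 1 \<le> i \<longrightarrow> i \<le> rank A (the (t v)) \<longrightarrow> qs ! (i - 1) \<in> the (\<rho> (v @ [i])))"
    if v: "v \<in> dom t" for v
  proof -
    let ?a = "the (t v)"
    have "(the (\<rho> v), ?a, succ_states ?B ?a \<rho> v) \<in> delta ?B"
      using run v by (simp add: is_run_iff)
    then obtain p qs where p: "the (\<rho> v) = R `` {p}" and step: "(p, ?a, qs) \<in> delta A"
      and qs: "succ_states ?B ?a \<rho> v = map (\<lambda>p. R `` {p}) qs"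
      by (auto simp: quotient_automaton_def)
    have "qs ! (i - 1) \<in> the (\<rho> (v @ [i]))" if i: "1 \<le> i" "i \<le> rank A ?a" for i
    proof -
      have len: "i - 1 < length qs" using trans_form[OF step] i by auto
      have "the (\<rho> (v @ [i])) = succ_states ?B ?a \<rho> v ! (i - 1)"
        using i by (auto simp: succ_states_def quotient_automaton_def simp del: upt_Suc)
      also have "\<dots> = R `` {qs ! (i - 1)}" using len by (simp add: qs)
      finally show ?thesis
        using equiv_class_self[OF R] trans_carrier[OF step] nth_mem[OF len] by auto
    qed
    then show ?thesis using p step by blast
  qed
  \<comment> \<open>The partial tree is encoded by the set \<open>D\<close> of its nodes. As
    \<open>the (\<rho> w)\<close> is a class, membership in it says that the state at a dangling
    leaf represents that class.\<close>
  define inv where "inv D \<pi> \<longleftrightarrow> tree_over A (t |` D) \<and> is_run A (t |` D) \<pi> \<and>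
      the (\<pi> []) \<in> initial A \<and>
      (\<forall>w. dangling_leaf (t |` D) \<pi> w \<longrightarrow> w \<in> dom t \<and> the (\<pi> w) \<in> the (\<rho> w))" for D \<pi>
  \<comment> \<open>Stated without \<open>inv D \<pi>\<close> to cover the creation of the root as
    well, where \<open>D\<close> is empty and the restriction of \<open>t\<close> is not a
    tree.\<close>
  have grow: "\<exists>\<sigma>. inv (insert v D) \<sigma>"
    if D: "D \<subseteq> dom t" and v: "v \<in> dom t" "v \<notin> D" "\<And>i. v @ [i] \<notin> D"
      and tree: "tree_over A ((t |` D)(v \<mapsto> the (t v)))"
      and dom: "dom \<pi> = insert v (run_domain (rank A) (t |` D))" and ran: "ran \<pi> \<subseteq> states A"
      and trans: "\<And>w. w \<in> dom (t |` D) \<Longrightarrow>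
        (the (\<pi> w), the ((t |` D) w), succ_states A (the ((t |` D) w)) \<pi> w) \<in> delta A"
      and step: "(the (\<pi> v), the (t v), qs) \<in> delta A"
      and qs: "\<And>i. 1 \<le> i \<Longrightarrow> i \<le> rank A (the (t v)) \<Longrightarrow> qs ! (i - 1) \<in> the (\<rho> (v @ [i]))"
      and root_init: "the (\<pi> []) \<in> initial A"
      and leaves: "\<And>w. w \<in> dom \<pi> \<Longrightarrow> w \<notin> D \<Longrightarrow> w \<noteq> v \<Longrightarrow> w \<in> dom t \<and> the (\<pi> w) \<in> the (\<rho> w)"
    for D v \<pi> qs
  proof -
    have v_D: "v \<notin> dom (t |` D)" "\<And>i. v @ [i] \<notin> dom (t |` D)" using v by simp_all
    obtain \<sigma> where \<sigma>: "is_run A ((t |` D)(v \<mapsto> the (t v))) \<sigma>"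
      and child: "\<And>i. 1 \<le> i \<Longrightarrow> i \<le> rank A (the (t v)) \<Longrightarrow> \<sigma> (v @ [i]) = Some (qs ! (i - 1))"
      and other: "\<And>w. (\<And>i. 1 \<le> i \<Longrightarrow> i \<le> rank A (the (t v)) \<Longrightarrow> w \<noteq> v @ [i]) \<Longrightarrow> \<sigma> w = \<pi> w"
      using run_extend[OF dom ran trans v_D step] by blast
    have eq: "(t |` D)(v \<mapsto> the (t v)) = t |` insert v D"
      using v by (auto simp: restrict_map_def)
    have "w \<in> dom t \<and> the (\<sigma> w) \<in> the (\<rho> w)" if w: "dangling_leaf (t |` insert v D) \<sigma> w" for w
    \<comment> \<open>A new leaf is a child of \<open>v\<close>, which lies in \<open>t\<close> by
      closedness and gets its state from \<open>qs\<close>; any other leaf is an old one with its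
      old state.\<close>
    proof (cases "\<exists>i. 1 \<le> i \<and> i \<le> rank A (the (t v)) \<and> w = v @ [i]")
      case True
      then show ?thesis using closed_tree_child[OF t closed v(1)] child qs by auto
    next
      case False
      then have "\<sigma> w = \<pi> w" by (intro other) blast
      then have "w \<in> dom \<pi>" "w \<notin> D" "w \<noteq> v"
        using w D v by (auto simp: dangling_leaf_def dom_def)
      then show ?thesis using leaves \<open>\<sigma> w = \<pi> w\<close> by simp
    qed
    moreover have "\<sigma> [] = \<pi> []" by (rule other) simp
    ultimately show ?thesis
      using \<sigma> tree root_init unfolding inv_def eq by metis
  qed
  have "\<exists>\<pi>. inv {[]} \<pi>"
  proof -
    obtain p qs where step: "(p, the (t []), qs) \<in> delta A" and p: "the (\<rho> []) = R `` {p}"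
      and qs: "\<And>i. 1 \<le> i \<Longrightarrow> i \<le> rank A (the (t [])) \<Longrightarrow> qs ! (i - 1) \<in> the (\<rho> ([] @ [i]))"
      using lift[OF root] by blast
    have "p \<in> states A" using trans_carrier[OF step] by simp
    \<comment> \<open>The class of \<open>p\<close> is initial because of some initial member
      \<open>i\<close>; upward inclusion of \<open>i\<close> in \<open>p\<close> then makes
      \<open>p\<close> itself initial.\<close>
    obtain i where i: "i \<in> initial A" "R `` {p} = R `` {i}"
      using init p by (auto simp: quotient_automaton_def)
    then have "(i, p) \<in> R"
      using eq_equiv_class[OF _ R] \<open>p \<in> states A\<close> by metis
    then have "p \<in> initial A"
      using i(1) by (simp add: R_def up_equiv_def up_incl_def)
    moreover have "the (t []) \<in> symbols A" using trans_carrier[OF step] by simp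
    then have "tree_over A ((t |` {})([] \<mapsto> the (t [])))" by (simp add: is_tree_def)
    ultimately show ?thesis
      using root step \<open>p \<in> states A\<close>
      by (intro grow[OF _ _ _ _ _ _ _ _ _ qs, where \<pi> = "[[] \<mapsto> p]"])
         (simp_all add: run_domain_def)
  qed
  have extend: "\<exists>v. v \<in> dom t - D \<and> (\<exists>\<sigma>. inv (insert v D) \<sigma>)"
    if D: "D \<subset> dom t" and inv: "inv D \<pi>" for D \<pi>
  proof -
    have dom_D: "dom (t |` D) = D" using D by auto
    have tree: "tree_over A (t |` D)" and runD: "is_run A (t |` D) \<pi>"
      and root_init: "the (\<pi> []) \<in> initial A"
      and leaves: "\<And>w. dangling_leaf (t |` D) \<pi> w \<Longrightarrow> w \<in> dom t \<and> the (\<pi> w) \<in> the (\<rho> w)"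
      using inv by (auto simp: inv_def)
    have "[] \<in> D" using root_in_dom[OF tree] dom_D by simp
    \<comment> \<open>A shortest missing node has its parent in \<open>D\<close>, hence is a
      dangling leaf of the partial run.\<close>
    obtain v where v: "v \<in> dom t - D" and min: "\<And>w. w \<in> dom t - D \<Longrightarrow> length v \<le> length w"
      using ex_has_least_nat[of "\<lambda>v. v \<in> dom t - D" _ length] D by blast
    then obtain u i where u: "v = u @ [i]"
      using \<open>[] \<in> D\<close> by (metis DiffD2 rev_exhaust)
    have i: "1 \<le> i" "u \<in> dom t" "i \<le> rank A (the (t u))"
      using t v unfolding u is_tree_def by blast+
    then have "u \<in> D" using min[of u] u by auto
    then have "v \<in> run_domain (rank A) (t |` D)"
      using i unfolding u by (intro child_in_run_domain) auto
    then have dangling: "dangling_leaf (t |` D) \<pi> v"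
      using runD v by (simp add: dangling_leaf_def is_run_iff)
    obtain p qs where step: "(p, the (t v), qs) \<in> delta A" and p: "the (\<rho> v) = R `` {p}"
      and qs: "\<And>i. 1 \<le> i \<Longrightarrow> i \<le> rank A (the (t v)) \<Longrightarrow> qs ! (i - 1) \<in> the (\<rho> (v @ [i]))"
      using lift[of v] v by blast
    \<comment> \<open>The current state at \<open>v\<close> and the required source \<open>p\<close>
      both belong to the class \<open>the (\<rho> v)\<close>.\<close>
    have "(the (\<pi> v), p) \<in> up_incl A (Id_on (states A))"
      using leaves[OF dangling] p by (auto simp: R_def up_equiv_def)
    from run_replace_state[OF this tree runD dangling refl]
    obtain \<sigma> where \<sigma>: "is_run A (t |` D) \<sigma>" "the (\<sigma> v) = p"
      and off_path: "\<And>w. \<not> prefix w v \<Longrightarrow> \<sigma> w = \<pi> w"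
      and \<sigma>_init: "the (\<sigma> []) \<in> initial A"
      using root_init by blast
    have tree_v: "tree_over A ((t |` D)(v \<mapsto> the (t v)))"
    proof -
      have fin: "finite D" using finite D finite_subset by blast
      have "1 \<le> j \<and> w \<in> insert v D \<and> j \<le> rank A (the (((t |` D)(v \<mapsto> the (t v))) w))"
        if "w @ [j] \<in> insert v D" for w j
      proof (cases "w @ [j] = v")
        case True
        then show ?thesis using u i \<open>u \<in> D\<close> v by auto
      next
        case False
        then have "w @ [j] \<in> dom (t |` D)" using that dom_D by simp
        then have "1 \<le> j \<and> w \<in> dom (t |` D) \<and> j \<le> rank A (the ((t |` D) w))"
          using tree unfolding is_tree_def by blast
        then show ?thesis using v by auto
      qed
      moreover have "dom ((t |` D)(v \<mapsto> the (t v))) = insert v D" using dom_D by simp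
      moreover have "ran ((t |` D)(v \<mapsto> the (t v))) \<subseteq> symbols A"
        using ran_t v by (auto simp: ran_def restrict_map_def split: if_splits)
      ultimately show ?thesis
        using fin unfolding is_tree_def by simp
    qed
    have no_child: "v @ [j] \<notin> D" for j
      using tree_prefix_closed[OF tree, of v "[j]"] v dom_D by auto
    have \<sigma>_leaves: "w \<in> dom t \<and> the (\<sigma> w) \<in> the (\<rho> w)" if w: "w \<in> dom \<sigma>" "w \<notin> D" "w \<noteq> v" for w
    proof -
      \<comment> \<open>Strict prefixes of \<open>v\<close> are in \<open>D\<close>, so every other
        leaf is off the path and keeps its state.\<close>
      have "\<not> strict_prefix w v"
        using run_domain_strict_prefix[OF tree \<open>v \<in> run_domain _ _\<close>] w dom_D by blast
      then have "\<sigma> w = \<pi> w" using w by (intro off_path) (auto simp: strict_prefix_def)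
      moreover from this have "dangling_leaf (t |` D) \<pi> w"
        using w dom_D by (auto simp: dangling_leaf_def dom_def)
      ultimately show ?thesis using leaves by simp
    qed
    have \<sigma>_run: "dom \<sigma> = insert v (run_domain (rank A) (t |` D))" "ran \<sigma> \<subseteq> states A"
      "\<And>w. w \<in> dom (t |` D) \<Longrightarrow>
        (the (\<sigma> w), the ((t |` D) w), succ_states A (the ((t |` D) w)) \<sigma> w) \<in> delta A"
      using \<sigma>(1) \<open>v \<in> run_domain _ _\<close> by (simp_all only: is_run_iff insert_absorb)
    have \<sigma>_step: "(the (\<sigma> v), the (t v), qs) \<in> delta A"
      unfolding \<sigma>(2) by (rule step)
    have "D \<subseteq> dom t" "v \<in> dom t" "v \<notin> D" using D v by blast+
    from grow[OF this no_child tree_v \<sigma>_run \<sigma>_step qs \<sigma>_init \<sigma>_leaves]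
    have "\<exists>\<sigma>. inv (insert v D) \<sigma>" .
    then show ?thesis using v by blast
  qed
  \<comment> \<open>Maximality replaces induction: among the finitely many node sets that admit the
    invariant, a maximal one cannot be extended and so is all of \<open>dom t\<close>.\<close>
  define \<D> where "\<D> = {D. D \<subseteq> dom t \<and> (\<exists>\<pi>. inv D \<pi>)}"
  have "finite \<D>" using finite by (simp add: \<D>_def)
  moreover have "{[]} \<in> \<D>"
    using \<open>\<exists>\<pi>. inv {[]} \<pi>\<close> root unfolding \<D>_def by blast
  ultimately obtain D where "D \<in> \<D>" and max: "\<And>E. E \<in> \<D> \<Longrightarrow> D \<subseteq> E \<Longrightarrow> D = E"
    using finite_has_maximal empty_iff by metis
  then obtain \<pi> where D: "D \<subseteq> dom t" and inv: "inv D \<pi>" by (auto simp: \<D>_def)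
  have "D = dom t"
  proof (rule ccontr)
    assume "D \<noteq> dom t"
    with D have "D \<subset> dom t" by blast
    from extend[OF this inv] obtain v where v: "v \<in> dom t - D" "\<exists>\<sigma>. inv (insert v D) \<sigma>" by blast
    then have "insert v D \<in> \<D>" using D unfolding \<D>_def by blast
    then have "D = insert v D" by (rule max) blast
    then show False using v(1) by blast
  qed
  then have "t |` D = t" by (auto simp: restrict_map_def dom_def)
  then show "t \<in> language A"
    using inv t closed by (auto simp: inv_def language_def)
qed

theorem theorem6:
  fixes A :: "('q, 'a) automaton"
  assumes "tdta A"
  shows "good_for_quotienting A (up_equiv A (Id_on (states A)))"
  unfolding good_for_quotienting_def
  using language_quotient_subset[OF assms] language_subset_quotient[OF assms] by blast

end
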